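(* Let $n$ and $l$ be integers with $1\leq l\leq n-1$. If ($n\geq 3$ is odd and $l\geq\frac{n+1}{2}$) or ($n\geq 4$ is even and $l>\frac{n}{2}$), then $T^*_n(l)$ is a regular semigroup.
   Context: For an integer $n\geq 2$, $X_n=\{1,2,\dots,n\}$ and $T_n$ is the full transformation semigroup on $X_n$ (all functions $X_n\to X_n$ under composition). The image of $x$ under $\alpha$ is written $x\alpha$, and functions are composed from left to right: $x(\alpha\beta)=(x\alpha)\beta$. For an integer $l$ with $1\leq l\leq n-1$, $T^*_n(l)=\{\alpha\in T_n : \forall x,y\in X_n,\ |x-y|=l \Leftrightarrow |x\alpha-y\alpha|=l\}$, which is a subsemigroup of $T_n$. A semigroup $S$ is regular if for every $a\in S$ there exists $b\in S$ with $a=aba$. *)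

theory Defs
  imports Main "HOL-Library.FuncSet"
begin

text \<open>The library's semigroup notions live on a whole type; here the carrier is a set.\<close>

definition semigroup_on :: "'a set \<Rightarrow> ('a \<Rightarrow> 'a \<Rightarrow> 'a) \<Rightarrow> bool" where
  "semigroup_on S m \<longleftrightarrow>
     (\<forall>a\<in>S. \<forall>b\<in>S. m a b \<in> S) \<and>
     (\<forall>a\<in>S. \<forall>b\<in>S. \<forall>c\<in>S. m (m a b) c = m a (m b c))"

definition regular_semigroup_on :: "'a set \<Rightarrow> ('a \<Rightarrow> 'a \<Rightarrow> 'a) \<Rightarrow> bool" where
  "regular_semigroup_on S m \<longleftrightarrow>
     semigroup_on S m \<and> (\<forall>a\<in>S. \<exists>b\<in>S. a = m (m a b) a)"

text \<open>
  A transformation of \<open>{1..n}\<close> is a function on \<open>nat\<close> that is \<open>undefined\<close> outside \<open>{1..n}\<close>,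
  so that equality of transformations is equality of functions.
\<close>

definition full_transf :: "nat \<Rightarrow> (nat \<Rightarrow> nat) set" where
  "full_transf n = {1..n} \<rightarrow>\<^sub>E {1..n}"

text \<open>Composition is from left to right: the first argument is applied first.\<close>

definition transf_mult :: "nat \<Rightarrow> (nat \<Rightarrow> nat) \<Rightarrow> (nat \<Rightarrow> nat) \<Rightarrow> (nat \<Rightarrow> nat)" where
  "transf_mult n \<alpha> \<beta> = compose {1..n} \<beta> \<alpha>"

text \<open>Distances are taken in \<open>int\<close> because subtraction on \<open>nat\<close> truncates.\<close>

definition dist_transf :: "nat \<Rightarrow> nat \<Rightarrow> (nat \<Rightarrow> nat) set" where
  "dist_transf n l = {\<alpha> \<in> full_transf n. \<forall>x\<in>{1..n}. \<forall>y\<in>{1..n}.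
     \<bar>int x - int y\<bar> = int l \<longleftrightarrow> \<bar>int (\<alpha> x) - int (\<alpha> y)\<bar> = int l}"

end

theory Submission
  imports Defs
begin

text \<open>
  Join \<open>x\<close> and \<open>y\<close> when their distance is \<open>l\<close>. Since \<open>n < 2 * l\<close>, every point has at most one
  neighbour, so an \<open>\<alpha>\<close> in \<open>T\<^sup>*\<^sub>n(l)\<close> is injective on the finite set of non-isolated points and
  therefore permutes it. Hence every point outside the image of \<open>\<alpha>\<close> is isolated, and the map
  sending a point of the image to some preimage and fixing all other points lies in \<open>T\<^sup>*\<^sub>n(l)\<close>.
\<close>

definition linked :: "nat \<Rightarrow> nat \<Rightarrow> nat set" where
  "linked n l = {x \<in> {1..n}. \<exists>y\<in>{1..n}. \<bar>int x - int y\<bar> = int l}"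

text \<open>Distinct points at distance \<open>l\<close> from \<open>z\<close> would lie on opposite
  sides of \<open>z\<close>, hence \<open>2 * l\<close> apart, which exceeds the diameter of
  \<open>{1..n}\<close>.\<close>

lemma neighbour_unique:
  assumes "n < 2 * l" "x \<in> {1..n}" "y \<in> {1..n}"
    and "\<bar>int z - int x\<bar> = int l" "\<bar>int z - int y\<bar> = int l"
  shows "x = y"
  using assms by (auto simp: abs_if split: if_splits)

lemma dist_transf_iff:
  assumes "\<alpha> \<in> dist_transf n l" "x \<in> {1..n}" "y \<in> {1..n}"
  shows "\<bar>int (\<alpha> x) - int (\<alpha> y)\<bar> = int l \<longleftrightarrow> \<bar>int x - int y\<bar> = int l"
  using assms by (auto simp: dist_transf_def)

lemma dist_transf_mem:
  assumes "\<alpha> \<in> dist_transf n l" "x \<in> {1..n}"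
  shows "\<alpha> x \<in> {1..n}"
  using assms unfolding dist_transf_def full_transf_def by blast

lemma dist_transf_image_linked:
  assumes "n < 2 * l" and \<alpha>: "\<alpha> \<in> dist_transf n l"
  shows "\<alpha> ` linked n l = linked n l"
proof (rule endo_inj_surj)
  show "finite (linked n l)"
    by (simp add: linked_def)
  show "\<alpha> ` linked n l \<subseteq> linked n l"
    using dist_transf_iff[OF \<alpha>] dist_transf_mem[OF \<alpha>] unfolding linked_def by blast
  show "inj_on \<alpha> (linked n l)"
  proof (rule inj_onI)
    fix x y
    assume "x \<in> linked n l" "y \<in> linked n l" and eq: "\<alpha> x = \<alpha> y"
    then obtain z where z: "z \<in> {1..n}" "\<bar>int z - int x\<bar> = int l"
      and xy: "x \<in> {1..n}" "y \<in> {1..n}"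
      by (auto simp: linked_def abs_minus_commute)
    \<comment> \<open>The distance from \<open>z\<close> to \<open>x\<close> passes to the images,
      where \<open>\<alpha> x = \<alpha> y\<close>, and is reflected back to \<open>z\<close> and
      \<open>y\<close>. So \<open>z\<close> is a common neighbour of \<open>x\<close> and
      \<open>y\<close>.\<close>
    then have "\<bar>int z - int y\<bar> = int l"
      using dist_transf_iff[OF \<alpha>] eq by metis
    then show "x = y"
      using neighbour_unique assms(1) z xy by blast
  qed
qed

lemma semigroup_on_dist_transf: "semigroup_on (dist_transf n l) (transf_mult n)"
  unfolding semigroup_on_def
proof (intro conjI ballI)
  fix \<alpha> \<beta>
  assume \<alpha>: "\<alpha> \<in> dist_transf n l" and \<beta>: "\<beta> \<in> dist_transf n l"
  have "transf_mult n \<alpha> \<beta> \<in> full_transf n"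
    unfolding full_transf_def transf_mult_def compose_def
    using dist_transf_mem[OF \<beta>] dist_transf_mem[OF \<alpha>] by (intro restrict_PiE_iff[THEN iffD2]) blast
  then show "transf_mult n \<alpha> \<beta> \<in> dist_transf n l"
    unfolding dist_transf_def transf_mult_def
    by (simp add: compose_eq dist_transf_mem[OF \<alpha>, simplified] dist_transf_iff[OF \<alpha>, simplified]
        dist_transf_iff[OF \<beta>, simplified])
next
  fix \<alpha> \<beta> \<gamma>
  assume "\<alpha> \<in> dist_transf n l"
  \<comment> \<open>The composite of \<open>\<beta>\<close> and \<open>\<gamma>\<close> is
    restricted to \<open>{1..n}\<close>, so it may be evaluated at \<open>\<alpha> x\<close> only
    because \<open>\<alpha> x\<close> stays in that set.\<close>
  then have "\<alpha> \<in> {1..n} \<rightarrow> {1..n}"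
    by (auto simp: dist_transf_def full_transf_def)
  then show "transf_mult n (transf_mult n \<alpha> \<beta>) \<gamma> = transf_mult n \<alpha> (transf_mult n \<beta> \<gamma>)"
    unfolding transf_mult_def by (rule compose_assoc)
qed

lemma dist_transf_pseudo_inverse:
  assumes "n < 2 * l" and \<alpha>: "\<alpha> \<in> dist_transf n l"
  obtains \<beta> where "\<beta> \<in> dist_transf n l"
    and "\<And>x. x \<in> {1..n} \<Longrightarrow> \<alpha> (\<beta> (\<alpha> x)) = \<alpha> x"
proof
  define \<beta> where "\<beta> = (\<lambda>y\<in>{1..n}. if y \<in> \<alpha> ` {1..n} then inv_into {1..n} \<alpha> y else y)"
  have mem: "\<beta> y \<in> {1..n}" if "y \<in> {1..n}" for y
    using that inv_into_into[of y \<alpha> "{1..n}"] by (simp add: \<beta>_def)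
  have right_inv: "\<alpha> (\<beta> y) = y" if "y \<in> {1..n}" "y \<in> \<alpha> ` {1..n}" for y
    using that by (simp add: \<beta>_def f_inv_into_f)
  have fixed: "\<beta> y = y" and isolated: "y \<notin> linked n l"
    if "y \<in> {1..n}" "y \<notin> \<alpha> ` {1..n}" for y
  proof -
    show "\<beta> y = y"
      using that by (simp add: \<beta>_def)
    have "linked n l \<subseteq> \<alpha> ` {1..n}"
      using dist_transf_image_linked[OF assms] unfolding linked_def by blast
    then show "y \<notin> linked n l"
      using that by blast
  qed
  have "\<bar>int (\<beta> y) - int (\<beta> z)\<bar> = int l \<longleftrightarrow> \<bar>int y - int z\<bar> = int l"
    if yz: "y \<in> {1..n}" "z \<in> {1..n}" for y z
  proof (cases "y \<in> \<alpha> ` {1..n} \<and> z \<in> \<alpha> ` {1..n}")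
    case True
    then show ?thesis
      \<comment> \<open>Apply the equivalence for \<open>\<alpha>\<close> to the chosen preimages
        \<open>\<beta> y\<close> and \<open>\<beta> z\<close>, whose images are \<open>y\<close> and
        \<open>z\<close>.\<close>
      using dist_transf_iff[OF \<alpha> mem mem, OF yz] right_inv yz by simp
  next
    case False
    \<comment> \<open>One of the two points is isolated and fixed by \<open>\<beta>\<close>. Both
      sides of the equivalence are then false, since either distance being \<open>l\<close> would
      give that point a neighbour in \<open>{1..n}\<close>.\<close>
    then consider "\<beta> y = y" "y \<notin> linked n l" | "\<beta> z = z" "z \<notin> linked n l"
      using fixed isolated yz by blast
    then show ?thesis
    proof cases
      case 1
      then show ?thesis
        using yz mem[OF yz(2)] unfolding linked_def by force
    next
      case 2
      then show ?thesis
        using yz mem[OF yz(1)] unfolding linked_def abs_minus_commute[of _ "int z"] by force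
    qed
  qed
  moreover have "\<beta> \<in> full_transf n"
    using mem unfolding full_transf_def by (auto simp: PiE_iff \<beta>_def)
  ultimately show "\<beta> \<in> dist_transf n l"
    by (simp add: dist_transf_def)
  show "\<alpha> (\<beta> (\<alpha> x)) = \<alpha> x" if "x \<in> {1..n}" for x
    using right_inv dist_transf_mem[OF \<alpha> that] that by blast
qed

theorem theorem4p2:
  fixes n l :: nat
  assumes "1 \<le> l" and "l \<le> n - 1"
    and "(n \<ge> 3 \<and> odd n \<and> l \<ge> (n + 1) div 2) \<or> (n \<ge> 4 \<and> even n \<and> l > n div 2)"
  shows "regular_semigroup_on (dist_transf n l) (transf_mult n)"
  unfolding regular_semigroup_on_def
proof (intro conjI ballI semigroup_on_dist_transf)
  fix \<alpha>
  assume \<alpha>: "\<alpha> \<in> dist_transf n l"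
  \<comment> \<open>For odd \<open>n\<close> the bound on \<open>l\<close> reads
    \<open>2 * l \<ge> n + 1\<close>; for even \<open>n\<close> it is this inequality
    halved.\<close>
  have "n < 2 * l"
    using assms(3) by presburger
  then obtain \<beta> where \<beta>: "\<beta> \<in> dist_transf n l"
    and *: "\<And>x. x \<in> {1..n} \<Longrightarrow> \<alpha> (\<beta> (\<alpha> x)) = \<alpha> x"
    using \<alpha> by (rule dist_transf_pseudo_inverse) blast
  \<comment> \<open>The identity \<open>*\<close> gives agreement on \<open>{1..n}\<close> only;
    equality of functions also requires both sides to be \<open>undefined\<close> elsewhere.\<close>
  have "\<alpha> \<in> extensional {1..n}"
    using \<alpha> by (auto simp: dist_transf_def full_transf_def PiE_iff)
  then have "\<alpha> = transf_mult n (transf_mult n \<alpha> \<beta>) \<alpha>"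
    unfolding transf_mult_def
    by (rule extensionalityI[OF _ compose_extensional]) (simp add: compose_eq *)
  then show "\<exists>\<beta>\<in>dist_transf n l. \<alpha> = transf_mult n (transf_mult n \<alpha> \<beta>) \<alpha>"
    using \<beta> by blast
qed

end
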